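(* Let $0<\mu<1$. The up rule $\textsc{row}(\mu)$ and the down rule $\textsc{derow}$ on Young's lattice of partitions of positive integers are compatible. Moreover, for every $i\ge1$, the distribution on $\mathcal{P}_i$ of the $\textsc{row}(\mu)$ process (the Markov chain started at the unique partition of $1$ with transitions given by $\textsc{row}(\mu)$, observed when it is in $\mathcal{P}_i$) is given by the probability function $$p(\lambda)=(1-\mu)^{i-N(\lambda)}\mu^{N(\lambda)-1}\frac{N(\lambda)!}{\prod_k r_k(\lambda)!},\qquad \lambda\in\mathcal{P}_i.$$
   Context: $\mathcal{P}_n$ is the set of integer partitions of the positive integer $n$. For $\lambda\in\mathcal{P}_n$, $N(\lambda)$ is the number of (positive) parts and $r_k(\lambda)\ge0$ is the number of parts of size $k$ ($k\ge1$). Young's lattice here is $\bigcup_{n\ge1}\mathcal{P}_n$ ordered by inclusion of Young diagrams, graded by $n$ with rank set $I=\{1,2,3,\dotsc\}$. Down rule $\textsc{derow}$: from a partition $\lambda$, choose one of its $N(\lambda)$ rows (parts) uniformly at random, let $\kappa$ be its length, and replace one part of size $\kappa$ by a part of size $\kappa-1$ (deleting it if $\kappa=1$). Up rule $\textsc{row}(\mu)$: from a partition $\lambda$, with probability $\mu$ add a new part of size $1$. Otherwise (with probability $1-\mu$) choose one of the $N(\lambda)$ rows uniformly at random, let $\kappa$ be its length, and replace one part of size $\kappa$ by a part of size $\kappa+1$. Write $T(\lambda\rightarrow\lambda')$ for the probability that the rule $T$ moves $\lambda$ to $\lambda'$. An up rule $U$ and a down rule $D$ are compatible if there are a Markov chain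 $(X_i\in\mathcal{P}_i)_{i\ge1}$ with $\mathrm{Prob}(X_i=u,X_{i+1}=v)=\mathrm{Prob}(X_i=u)U(u\rightarrow v)$ for all $i\ge1$ and all $u,v$, and a Markov chain $(Y_i\in\mathcal{P}_i)_{i\ge1}$ with $\mathrm{Prob}(Y_i=u,Y_{i-1}=v)=\mathrm{Prob}(Y_i=u)D(u\rightarrow v)$ for all $i\ge2$ and all $u,v$, such that $X_i$ and $Y_i$ are equally distributed for every $i\ge1$. *)

theory Defs
  imports "HOL-Probability.Probability"
begin

text \<open>A partition is the multiset of its (positive) parts, so \<open>size \<nu>\<close> is the number of parts
  and \<open>count \<nu> k\<close> is the number of parts of size \<open>k\<close>.\<close>

definition partitions :: "nat \<Rightarrow> nat multiset set" where
  "partitions n = {\<nu>. 0 \<notin># \<nu> \<and> \<Sum>\<^sub># \<nu> = n}"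

lemma partitions_1: "partitions 1 = {{#1#}}"
proof -
  have "\<nu> = {#1#}" if parts: "0 \<notin># \<nu>" "\<Sum>\<^sub># \<nu> = 1" for \<nu> :: "nat multiset"
  proof (cases \<nu>)
    case empty
    with parts show ?thesis by simp
  next
    case (add k \<nu>')
    with parts have "k \<noteq> 0" "k + \<Sum>\<^sub># \<nu>' = 1" by auto
    then have "k = 1" "\<Sum>\<^sub># \<nu>' = 0" by linarith+
    moreover from this add parts have "\<nu>' = {#}"
      by (cases \<nu>') auto
    ultimately show ?thesis using add by simp
  qed
  then show ?thesis by (auto simp: partitions_def)
qed

text \<open>\<open>pmf_of_multiset\<close> counts multiplicities: drawing from it is drawing a row uniformly and
  recording its length. It is unspecified at \<open>{#}\<close>, which is not a partition of a positive
  integer.\<close>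

definition derow_rule :: "nat multiset \<Rightarrow> nat multiset pmf" where
  "derow_rule \<nu> = map_pmf
     (\<lambda>\<kappa>. if \<kappa> = 1 then \<nu> - {#\<kappa>#} else add_mset (\<kappa> - 1) (\<nu> - {#\<kappa>#}))
     (pmf_of_multiset \<nu>)"

definition row_rule :: "real \<Rightarrow> nat multiset \<Rightarrow> nat multiset pmf" where
  "row_rule \<mu> \<nu> = bind_pmf (bernoulli_pmf \<mu>) (\<lambda>new_part.
     if new_part then return_pmf (add_mset 1 \<nu>)
     else map_pmf (\<lambda>\<kappa>. add_mset (\<kappa> + 1) (\<nu> - {#\<kappa>#})) (pmf_of_multiset \<nu>))"

text \<open>Markov chains \<open>(X\<^sub>i \<in> partitions i)\<close> indexed by \<open>i \<ge> 1\<close>, in general inhomogeneous.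
  The state spaces are finite, so conditioning on single histories suffices.
  The Markov property is invariant under reversal of time, hence the same notion
  serves for chains that are driven downwards.\<close>

definition markov_chain :: "'w measure \<Rightarrow> (nat \<Rightarrow> 'w \<Rightarrow> nat multiset) \<Rightarrow> bool" where
  "markov_chain M X \<longleftrightarrow>
     prob_space M \<and>
     (\<forall>i\<ge>1. X i \<in> measurable M (count_space (partitions i))) \<and>
     (\<forall>i\<ge>1. \<forall>x. \<P>(\<omega> in M. \<forall>j\<in>{1..i}. X j \<omega> = x j) > 0 \<longrightarrow>
        \<P>(\<omega> in M. X (i + 1) \<omega> = x (i + 1) \<bar> \<forall>j\<in>{1..i}. X j \<omega> = x j) =
        \<P>(\<omega> in M. X (i + 1) \<omega> = x (i + 1) \<bar> X i \<omega> = x i))"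

text \<open>The initial state of an up chain is \<open>{#1#}\<close>, by \<open>partitions_1\<close>.\<close>

definition up_chain ::
    "(nat multiset \<Rightarrow> nat multiset pmf) \<Rightarrow> 'w measure \<Rightarrow> (nat \<Rightarrow> 'w \<Rightarrow> nat multiset) \<Rightarrow> bool" where
  "up_chain U M X \<longleftrightarrow> markov_chain M X \<and>
     (\<forall>i\<ge>1. \<forall>u v. \<P>(\<omega> in M. X i \<omega> = u \<and> X (i + 1) \<omega> = v) =
        \<P>(\<omega> in M. X i \<omega> = u) * pmf (U u) v)"

definition down_chain ::
    "(nat multiset \<Rightarrow> nat multiset pmf) \<Rightarrow> 'w measure \<Rightarrow> (nat \<Rightarrow> 'w \<Rightarrow> nat multiset) \<Rightarrow> bool" where
  "down_chain D M Y \<longleftrightarrow> markov_chain M Y \<and>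
     (\<forall>i\<ge>2. \<forall>u v. \<P>(\<omega> in M. Y i \<omega> = u \<and> Y (i - 1) \<omega> = v) =
        \<P>(\<omega> in M. Y i \<omega> = u) * pmf (D u) v)"

text \<open>The two chains may live on different probability spaces. Taking path space
  as the underlying type is no restriction, since only the laws of the chains matter.\<close>

definition compatible ::
    "(nat multiset \<Rightarrow> nat multiset pmf) \<Rightarrow> (nat multiset \<Rightarrow> nat multiset pmf) \<Rightarrow> bool" where
  "compatible U D \<longleftrightarrow>
     (\<exists>(M :: (nat \<Rightarrow> nat multiset) measure) X (M' :: (nat \<Rightarrow> nat multiset) measure) Y.
        up_chain U M X \<and> down_chain D M' Y \<and>
        (\<forall>i\<ge>1. distr M (count_space (partitions i)) (X i) =
               distr M' (count_space (partitions i)) (Y i)))"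

end

theory Submission
  imports Defs
begin

text \<open>The row rule and the derow rule are in detailed balance with respect to the claimed
  probabilities \<open>p\<close>: if \<open>u\<close> is a partition of \<open>i\<close> and \<open>v\<close> a partition of \<open>i + 1\<close>, then
  \<open>p(u) row(u \<rightarrow> v) = p(v) derow(v \<rightarrow> u)\<close> (lemma \<open>detailed_balance\<close>).

  This is best seen on compositions. The factor \<open>N! / (\<Prod>k. r\<^sub>k!)\<close> is the number of ways to order the
  parts of a partition, so \<open>p\<close> is the distribution of the sorted version of a random composition which
  has probability \<open>(1 - \<mu>)\<^bsup>i - N\<^esup> \<mu>\<^bsup>N - 1\<^esup>\<close> if it has \<open>N\<close> parts. Choosing a row uniformly at random
  and setting it aside leaves an arbitrary arrangement of the other parts (lemma
  \<open>arrangements_remove\<close>). The number of these arrangements is the same before and after the chosen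
  row is lengthened, and the powers of \<open>\<mu>\<close> and \<open>1 - \<mu>\<close> are adapted to the two kinds of up step.

  Summing detailed balance over \<open>u\<close> shows that one up step carries \<open>p\<close> on the partitions of \<open>i\<close> to \<open>p\<close>
  on the partitions of \<open>i + 1\<close>, whence by induction the law of every row chain (lemma
  \<open>row_chain_law\<close>). Given this law, detailed balance states that the row chain, observed backwards,
  makes derow steps (lemma \<open>row_chain_reverse\<close>). Since the Markov property does not depend on the
  direction of time, a single chain serves as \<open>X\<close> and as \<open>Y\<close>, and compatibility follows as soon as a
  row chain exists at all; it is constructed with the Ionescu-Tulcea theorem (lemmas
  \<open>inhomogeneous_Markov_measure\<close> and \<open>up_chain_exists\<close>).\<close>

section \<open>Arrangements of the parts\<close>

text \<open>The multinomial coefficient counts the ways to put the parts in order, that is, the compositions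
  that sort to \<open>\<nu>\<close> (see \<open>arrangements_card\<close>).\<close>

definition arrangements :: "nat multiset \<Rightarrow> real" where
  "arrangements \<nu> = fact (size \<nu>) / (\<Prod>k\<in>set_mset \<nu>. fact (count \<nu> k))"

text \<open>The candidate for the distribution, with the integer that is partitioned read off from the
  partition as its sum.\<close>

definition row_law :: "real \<Rightarrow> nat multiset \<Rightarrow> real" where
  "row_law \<mu> \<nu> = (1 - \<mu>) ^ (\<Sum>\<^sub># \<nu> - size \<nu>) * \<mu> ^ (size \<nu> - 1) * arrangements \<nu>"

lemma arrangements_card: "arrangements \<nu> = card (permutations_of_multiset \<nu>)"
proof -
  have "real (card (permutations_of_multiset \<nu>) * (\<Prod>k\<in>set_mset \<nu>. fact (count \<nu> k))) = real (fact (size \<nu>))"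
    by (simp only: card_permutations_of_multiset_aux)
  then have "real (card (permutations_of_multiset \<nu>)) * (\<Prod>k\<in>set_mset \<nu>. fact (count \<nu> k)) = fact (size \<nu>)"
    by simp
  moreover have "(\<Prod>k\<in>set_mset \<nu>. fact (count \<nu> k)) \<noteq> (0::real)" by simp
  ultimately show ?thesis unfolding arrangements_def by (simp add: field_simps)
qed

text \<open>A fraction \<open>count \<nu> k / size \<nu>\<close> of all arrangements of \<open>\<nu>\<close> starts with \<open>k\<close>, and what follows this
  first entry is an arbitrary arrangement of the rest. The fraction is also the probability that a
  uniformly random row of \<open>\<nu>\<close> has length \<open>k\<close>.\<close>

lemma arrangements_remove:
  assumes "k \<in># \<nu>"
  shows "arrangements \<nu> * (count \<nu> k / size \<nu>) = arrangements (\<nu> - {#k#})"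
proof -
  have "size \<nu> * card (permutations_of_multiset (\<nu> - {#k#})) = card (permutations_of_multiset \<nu>) * count \<nu> k"
    using card_permutations_of_multiset_remove_aux[OF assms] by (simp add: mult_ac)
  moreover have "size \<nu> \<noteq> 0" using assms by auto
  ultimately show ?thesis unfolding arrangements_card
    by (simp add: field_simps flip: of_nat_mult)
qed

section \<open>Partitions and the two rules\<close>

lemma size_le_sum: "0 \<notin># \<nu> \<Longrightarrow> size \<nu> \<le> \<Sum>\<^sub># (\<nu> :: nat multiset)"
  by (induction \<nu>) auto

lemma finite_partitions: "finite (partitions n)"
proof (rule finite_subset)
  show "partitions n \<subseteq> mset ` {xs. set xs \<subseteq> {..n} \<and> length xs \<le> n}"
  proof
    fix \<nu> assume "\<nu> \<in> partitions n"
    then have \<nu>: "0 \<notin># \<nu>" "\<Sum>\<^sub># \<nu> = n" by (auto simp: partitions_def)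
    obtain xs where xs: "\<nu> = mset xs" by (metis ex_mset)
    have "length xs \<le> n" using size_le_sum[OF \<nu>(1)] \<nu>(2) xs by auto
    moreover have "set xs \<subseteq> {..n}" using \<nu>(2) xs by (auto simp: sum_mset_sum_list intro: member_le_sum_list)
    ultimately show "\<nu> \<in> mset ` {xs. set xs \<subseteq> {..n} \<and> length xs \<le> n}" using xs by blast
  qed
qed (auto intro: finite_lists_length_le)

lemma partition_nonempty: "\<nu> \<in> partitions i \<Longrightarrow> i \<ge> 1 \<Longrightarrow> \<nu> \<noteq> {#}"
  by (auto simp: partitions_def)

lemma pmf_map_multiset:
  assumes "\<nu> \<noteq> {#}"
  shows "pmf (map_pmf f (pmf_of_multiset \<nu>)) w =
     (\<Sum>k\<in>{k\<in>set_mset \<nu>. f k = w}. count \<nu> k / size \<nu>)"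
proof -
  have "pmf (map_pmf f (pmf_of_multiset \<nu>)) w = measure (pmf_of_multiset \<nu>) (f -` {w})"
    by (simp add: pmf_map)
  also have "\<dots> = measure (pmf_of_multiset \<nu>) {k\<in>set_mset \<nu>. f k = w}"
    using assms by (intro measure_prob_cong_0) (auto simp: not_in_iff)
  also have "\<dots> = (\<Sum>k\<in>{k\<in>set_mset \<nu>. f k = w}. count \<nu> k / size \<nu>)"
    using assms by (subst measure_measure_pmf_finite) auto
  finally show ?thesis .
qed

lemma set_pmf_row_rule:
  assumes "u \<in> partitions i" "i \<ge> 1"
  shows "set_pmf (row_rule \<mu> u) \<subseteq> partitions (Suc i)"
proof -
  have "add_mset (k + 1) (u - {#k#}) \<in> partitions (Suc i)" if "k \<in># u" for k
  proof -
    obtain c where "u = add_mset k c" using \<open>k \<in># u\<close> by (blast dest: multi_member_split)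
    then show ?thesis using assms by (auto simp: partitions_def)
  qed
  moreover have "add_mset 1 u \<in> partitions (Suc i)" using assms by (auto simp: partitions_def)
  ultimately show ?thesis using partition_nonempty[OF assms]
    by (auto simp: row_rule_def split: if_splits)
qed

lemma set_pmf_derow_rule:
  assumes "v \<in> partitions (Suc i)"
  shows "set_pmf (derow_rule v) \<subseteq> partitions i"
proof -
  let ?f = "\<lambda>k. if k = 1 then v - {#k#} else add_mset (k - 1) (v - {#k#})"
  have "?f k \<in> partitions i" if "k \<in># v" for k
  proof -
    obtain c where "v = add_mset k c" using \<open>k \<in># v\<close> by (blast dest: multi_member_split)
    then show ?thesis using assms by (auto simp: partitions_def)
  qed
  then have "?f ` set_mset v \<subseteq> partitions i" by (rule image_subsetI)
  moreover have "set_pmf (derow_rule v) = ?f ` set_mset v"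
    using partition_nonempty[OF assms] by (simp only: derow_rule_def set_map_pmf set_pmf_of_multiset One_nat_def) simp
  ultimately show ?thesis by (simp only:)
qed

text \<open>The sum has at most one term, because distinct row lengths lead to distinct partitions. It is kept
  as a sum, so that detailed balance can match it term by term with the one for the down rule.\<close>

lemma pmf_row_rule:
  assumes "0 \<le> \<mu>" "\<mu> \<le> 1" "u \<noteq> {#}"
  shows "pmf (row_rule \<mu> u) v = \<mu> * of_bool (v = add_mset 1 u) +
     (1 - \<mu>) * (\<Sum>k\<in>{k\<in>set_mset u. add_mset (k + 1) (u - {#k#}) = v}. count u k / size u)"
  unfolding row_rule_def using assms
  by (simp add: pmf_bind pmf_map_multiset[OF assms(3)] integral_measure_pmf_real[where A=UNIV] UNIV_bool)

section \<open>Detailed balance\<close>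

text \<open>Each way of going up from \<open>u\<close> to \<open>v\<close> is matched with the way of going down that undoes it:
  lengthening a row of length \<open>k\<close> with shortening a row of length \<open>k + 1\<close>, and adding a part \<open>1\<close> with
  deleting one. In the first case \<open>u\<close> and \<open>v\<close> become the same multiset once the row concerned is
  removed, so that by \<open>arrangements_remove\<close> both sides carry the same number of arrangements; the
  numbers of parts agree, and the factor \<open>1 - \<mu>\<close> makes up for the additional box. In the second case
  removing the new part from \<open>v\<close> gives \<open>u\<close>, and \<open>\<mu>\<close> makes up for the additional part.\<close>

lemma detailed_balance:
  assumes \<mu>: "0 < \<mu>" "\<mu> < 1" and u: "u \<in> partitions i" "i \<ge> 1" and v: "v \<in> partitions (Suc i)"
  shows "row_law \<mu> u * pmf (row_rule \<mu> u) v = row_law \<mu> v * pmf (derow_rule v) u"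
proof -
  have ne: "u \<noteq> {#}" "v \<noteq> {#}" using partition_nonempty u v by auto
  have u0: "0 \<notin># u" "\<Sum>\<^sub># u = i" "size u \<le> i" and v0: "0 \<notin># v" "\<Sum>\<^sub># v = Suc i"
    using u v size_le_sum[of u] by (auto simp: partitions_def)
  let ?K = "{k\<in>set_mset u. add_mset (k + 1) (u - {#k#}) = v}"
  let ?g = "\<lambda>k. if k = 1 then v - {#k#} else add_mset (k - 1) (v - {#k#})"
  let ?G = "{k\<in>set_mset v. ?g k = u}"
  let ?t = "\<lambda>k. row_law \<mu> v * (count v k / size v)"
  have split: "?G = Suc ` ?K \<union> (if v = add_mset 1 u then {1} else {})" (is "_ = ?R")
  proof
    show "?G \<subseteq> ?R"
    proof
      fix k assume k: "k \<in> ?G"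
      show "k \<in> ?R"
      proof (cases "k = 1")
        case False
        then obtain j where "k = Suc j" "j \<ge> 1" using k v0 by (cases k) auto
        then show ?thesis using k by (auto intro!: image_eqI[of _ _ j])
      qed (use k in auto)
    qed
    have "Suc k \<in> ?G" if "k \<in> ?K" for k
    proof -
      have "k \<in># u" "v = add_mset (Suc k) (u - {#k#})" using that by auto
      moreover have "k \<noteq> 0" using \<open>k \<in># u\<close> u0 by metis
      ultimately show ?thesis by simp
    qed
    moreover have "1 \<in> ?G" if "v = add_mset 1 u" using that by simp
    ultimately show "?R \<subseteq> ?G" by (simp add: image_subset_iff)
  qed
  have disj: "Suc ` ?K \<inter> (if v = add_mset 1 u then {1} else {}) = {}"
    using u0 by auto
  have grow: "row_law \<mu> u * ((1 - \<mu>) * (count u k / size u)) = ?t (Suc k)" if "k \<in> ?K" for k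
  proof -
    have k: "k \<in># u" "v = add_mset (k + 1) (u - {#k#})" using that by auto
    have sz: "size v = size u" using k by (simp add: size_Diff_singleton) (metis One_nat_def Suc_pred ne(1) nonempty_has_size)
    have "arrangements v * (count v (Suc k) / size v) = arrangements (v - {#Suc k#})"
      by (rule arrangements_remove) (use k in auto)
    also have "v - {#Suc k#} = u - {#k#}" using k by simp
    also have "arrangements \<dots> = arrangements u * (count u k / size u)"
      using arrangements_remove[OF k(1)] by simp
    finally have a: "arrangements v * (count v (Suc k) / size v) = arrangements u * (count u k / size u)" .
    have "?t (Suc k) = (1 - \<mu>) ^ (Suc i - size u) * \<mu> ^ (size u - 1) * (arrangements v * (count v (Suc k) / size v))"
      by (simp add: row_law_def sz v0)
    also have "\<dots> = row_law \<mu> u * ((1 - \<mu>) * (count u k / size u))"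
      unfolding a using u0 by (simp add: row_law_def Suc_diff_le)
    finally show ?thesis by simp
  qed
  have new: "row_law \<mu> u * \<mu> = ?t 1" if "v = add_mset 1 u"
  proof -
    have "arrangements v * (count v 1 / size v) = arrangements u"
      using arrangements_remove[of 1 v] that by simp
    moreover have "?t 1 = (1 - \<mu>) ^ (i - size u) * \<mu> ^ size u * (arrangements v * (count v 1 / size v))"
      by (simp add: row_law_def that u0)
    moreover have "\<mu> ^ size u = \<mu> ^ (size u - 1) * \<mu>" using ne by (cases u) auto
    ultimately show ?thesis using u0 by (simp add: row_law_def)
  qed
  have "row_law \<mu> v * pmf (derow_rule v) u = (\<Sum>k\<in>?G. ?t k)"
    unfolding derow_rule_def by (simp add: pmf_map_multiset[OF ne(2)] sum_distrib_left)
  also have "\<dots> = (\<Sum>k\<in>Suc ` ?K. ?t k) + (\<Sum>k\<in>(if v = add_mset 1 u then {1} else {}). ?t k)"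
    unfolding split using disj by (intro sum.union_disjoint) auto
  also have "(\<Sum>k\<in>Suc ` ?K. ?t k) = (\<Sum>k\<in>?K. ?t (Suc k))"
    by (subst sum.reindex) (simp_all only: inj_Suc o_def)
  also have "\<dots> = (\<Sum>k\<in>?K. row_law \<mu> u * ((1 - \<mu>) * (count u k / size u)))"
    by (rule sum.cong[OF refl grow[symmetric]])
  also have "(\<Sum>k\<in>(if v = add_mset 1 u then {1} else {}). ?t k) = row_law \<mu> u * (\<mu> * of_bool (v = add_mset 1 u))"
    using new by auto
  also have "(\<Sum>k\<in>?K. row_law \<mu> u * ((1 - \<mu>) * (count u k / size u))) =
      row_law \<mu> u * ((1 - \<mu>) * (\<Sum>k\<in>?K. count u k / size u))"
    by (simp only: sum_distrib_left)
  also have "row_law \<mu> u * ((1 - \<mu>) * (\<Sum>k\<in>?K. count u k / size u)) +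
      row_law \<mu> u * (\<mu> * of_bool (v = add_mset 1 u)) = row_law \<mu> u * pmf (row_rule \<mu> u) v"
    using pmf_row_rule[of \<mu> u v] \<mu> ne by (simp only: less_imp_le not_False_eq_True distrib_left add.commute)
  finally show ?thesis ..
qed

section \<open>Existence of Markov chains\<close>

lemma emeasure_pmf_superset:
  assumes "set_pmf p \<subseteq> A"
  shows "emeasure (measure_pmf p) A = 1"
proof (rule measure_pmf.emeasure_eq_1_AE)
  show "AE x in measure_pmf p. x \<in> A" using assms by (auto simp: AE_measure_pmf_iff)
qed simp

text \<open>Existence, on path space, of the Markov chain with prescribed kernels \<open>K\<close>, from the
  Ionescu-Tulcea theorem. The state spaces \<open>S n\<close> are built into the \<open>\<sigma>\<close>-algebra, so that every
  path, and not just almost every path, stays in them. Allowing an arbitrary event \<open>A\<close> of the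
  past in the last clause makes it contain both the one-step transition probabilities (for \<open>A\<close>
  the whole space) and the Markov property (for \<open>A\<close> a single history).\<close>

lemma inhomogeneous_Markov_measure:
  fixes S :: "nat \<Rightarrow> 's set" and K :: "nat \<Rightarrow> 's \<Rightarrow> 's pmf"
  assumes start: "x0 \<in> S 0"
    and closed: "\<And>n u. u \<in> S n \<Longrightarrow> set_pmf (K n u) \<subseteq> S (Suc n)"
  obtains M :: "(nat \<Rightarrow> 's) measure" where
    "prob_space M"
    "sets M = sets (PiM UNIV (\<lambda>n. count_space (S n)))"
    "\<And>n A u v. A \<in> sets (PiM {0..<Suc n} (\<lambda>n. count_space (S n))) \<Longrightarrow>
       \<P>(\<omega> in M. restrict \<omega> {0..<Suc n} \<in> A \<and> \<omega> n = u \<and> \<omega> (Suc n) = v) =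
       \<P>(\<omega> in M. restrict \<omega> {0..<Suc n} \<in> A \<and> \<omega> n = u) * pmf (K n u) v"
proof -
  define N where "N n = count_space (S n)" for n
  \<comment> \<open>Outside of paths in the state spaces \<open>K\<close> is unconstrained, which does no harm: the kernels
    only have to be probability measures after a past in \<open>space (PiM {0..<n} N)\<close>.\<close>
  define P where "P n \<omega> = (case n of 0 \<Rightarrow> return (N 0) x0
      | Suc m \<Rightarrow> restrict_space (measure_pmf (K m (\<omega> m))) (S n))" for n \<omega>
  have prob_P: "prob_space (P n \<omega>)" if "\<omega> \<in> space (PiM {0..<n} N)" for n \<omega>
  proof (cases n)
    case 0
    then show ?thesis using start by (auto simp: P_def N_def intro!: prob_space_return)
  next
    case (Suc m)
    then have "\<omega> m \<in> S m" using that by (auto simp: space_PiM N_def PiE_iff)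
    then have "set_pmf (K m (\<omega> m)) \<subseteq> S n" using closed Suc by auto
    then have "emeasure (measure_pmf (K m (\<omega> m))) (S n) = 1"
      by (rule emeasure_pmf_superset)
    then show ?thesis using Suc
      by (auto simp: P_def intro!: prob_space_restrict_space)
  qed
  have meas_P: "P n \<in> measurable (PiM {0..<n} N) (subprob_algebra (N n))" for n
  proof (cases n)
    case 0
    have "return (N 0) x0 \<in> space (subprob_algebra (N 0))"
      by (auto simp: N_def space_subprob_algebra start intro!: subprob_space_return)
    moreover have "P 0 = (\<lambda>_. return (N 0) x0)" by (rule ext) (simp add: P_def)
    ultimately show ?thesis using 0 by simp
  next
    case (Suc m)
    let ?g = "\<lambda>u. restrict_space (measure_pmf (K m u)) (S (Suc m))"
    have P: "P n = ?g \<circ> (\<lambda>\<omega>. \<omega> m)" using Suc by (auto simp: P_def)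
    have "?g \<in> measurable (N m) (subprob_algebra (N n))"
    proof -
      have "?g u \<in> space (subprob_algebra (N n))" if "u \<in> S m" for u
      proof -
        have "emeasure (measure_pmf (K m u)) (S n) = 1" using closed[OF that] Suc
          by (simp add: emeasure_pmf_superset)
        then have "prob_space (?g u)" using Suc by (intro prob_space_restrict_space) auto
        then show ?thesis
          by (auto simp: space_subprob_algebra Suc N_def sets_restrict_space 
              prob_space_imp_subprob_space)
      qed
      then show ?thesis by (auto simp: N_def)
    qed
    then show ?thesis unfolding P
      by (intro measurable_comp[OF measurable_component_singleton]) (auto simp: Suc)
  qed
  interpret IT: Ionescu_Tulcea P N by (rule Ionescu_Tulcea.intro[OF meas_P prob_P])
  let ?L = IT.PF.lim
  have sets_L: "sets ?L = sets (PiM UNIV N)" by (rule IT.PF.sets_lim)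
  have space_L: "space ?L = space (PiM UNIV N)" by (rule sets_eq_imp_space_eq[OF sets_L])
  have u0: "(\<lambda>_. undefined) \<in> space (PiM {0..<0} N)" by (simp add: space_PiM)
  have cyl: "emeasure ?L {\<omega>\<in>space ?L. restrict \<omega> {0..<n} \<in> B} = emeasure (IT.C 0 n (\<lambda>_. undefined)) B"
    if "B \<in> sets (PiM {0..<n} N)" for n B
  proof -
    have "{\<omega>\<in>space ?L. restrict \<omega> {0..<n} \<in> B} = IT.PF.emb UNIV {0..<n} B"
      by (auto simp: prod_emb_def space_L space_PiM)
    moreover have "IT.PF.emb {0..<n} {0..<n} B = B"
      by (rule prod_emb_id) (use sets.sets_into_space[OF that] in \<open>simp add: space_PiM\<close>)
    ultimately show ?thesis using that by (simp add: IT.lim IT.emeasure_CI[of _ n])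
  qed
  show thesis
  proof
    have "{\<omega>\<in>space ?L. restrict \<omega> {0..<0} \<in> space (PiM {0..<0} N)} = space ?L"
      by (auto simp: space_PiM)
    then have "emeasure ?L (space ?L) = emeasure (IT.C 0 0 (\<lambda>_. undefined)) (space (PiM {0..<0} N))"
      using cyl[OF sets.top, of 0] by simp
    also have "\<dots> = 1"
      using u0 by simp
    finally show "prob_space ?L" by (rule prob_spaceI)
    show "sets ?L = sets (PiM UNIV (\<lambda>n. count_space (S n)))"
      using sets_L by (simp add: N_def[abs_def])
  next
    fix n A u v
    assume "A \<in> sets (PiM {0..<Suc n} (\<lambda>n. count_space (S n)))"
    then have A[measurable]: "A \<in> sets (PiM {0..<Suc n} N)" by (simp add: N_def[abs_def])
    have comp[measurable]: "(\<lambda>\<omega>. \<omega> j) \<in> measurable (PiM I N) (count_space (S j))" if "j \<in> I" for I j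
      using measurable_component_singleton[OF that, of N] by (simp add: N_def)
    have single: "{\<omega>\<in>space (PiM I N). \<omega> j = w} \<in> sets (PiM I N)" if "j \<in> I" for I j w
    proof -
      have "{\<omega>\<in>space (PiM I N). \<omega> j = w} = (\<lambda>\<omega>. \<omega> j) -` ({w} \<inter> S j) \<inter> space (PiM I N)"
        using that by (auto simp: space_PiM N_def PiE_iff extensional_def)
      then show ?thesis using measurable_sets[OF comp[OF that], of "{w} \<inter> S j"] by simp
    qed
    let ?A = "{\<omega>\<in>space (PiM {0..<Suc n} N). \<omega> \<in> A \<and> \<omega> n = u}"
    let ?B = "{\<omega>\<in>space (PiM {0..<Suc (Suc n)} N).
        restrict \<omega> {0..<Suc n} \<in> A \<and> \<omega> n = u \<and> \<omega> (Suc n) = v}"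
    have A': "?A \<in> sets (PiM {0..<Suc n} N)"
    proof -
      have "?A = A \<inter> {\<omega>\<in>space (PiM {0..<Suc n} N). \<omega> n = u}" using sets.sets_into_space[OF A] by auto
      then show ?thesis using single[of n "{0..<Suc n}" u] by simp
    qed
    have B': "?B \<in> sets (PiM {0..<Suc (Suc n)} N)"
    proof -
      have r: "(\<lambda>\<omega>. restrict \<omega> {0..<Suc n}) \<in> measurable (PiM {0..<Suc (Suc n)} N) (PiM {0..<Suc n} N)"
        by (rule measurable_restrict_subset) auto
      have "?B = ((\<lambda>\<omega>. restrict \<omega> {0..<Suc n}) -` A \<inter> space (PiM {0..<Suc (Suc n)} N))
         \<inter> {\<omega>\<in>space (PiM {0..<Suc (Suc n)} N). \<omega> n = u} \<inter> {\<omega>\<in>space (PiM {0..<Suc (Suc n)} N). \<omega> (Suc n) = v}"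
        by auto
      then show ?thesis using measurable_sets[OF r A] single[of n "{0..<Suc (Suc n)}" u]
        single[of "Suc n" "{0..<Suc (Suc n)}" v] by (metis (no_types, lifting) sets.Int atLeastLessThan_iff zero_le lessI less_SucI)
    qed
    let ?C = "IT.C 0 (Suc n) (\<lambda>_. undefined)"
    have C_space: "space ?C = space (PiM {0..<Suc n} N)" using IT.space_C[OF u0, of "Suc n"] by simp
    have C_sets: "sets ?C = sets (PiM {0..<Suc n} N)" using IT.sets_C[OF u0, of "Suc n"] by simp
    have restr: "restrict (restrict \<omega> {0..<m}) {0..<k} = restrict \<omega> {0..<k}" if "k \<le> m" for \<omega> :: "nat \<Rightarrow> 's" and m k
      using that by (auto simp: restrict_def fun_eq_iff)
    have inL: "restrict \<omega> {0..<m} \<in> space (PiM {0..<m} N)" if "\<omega> \<in> space ?L" for \<omega> m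
      using that by (auto simp: space_L space_PiM PiE_iff)
    \<comment> \<open>The extension by one step sees the past only through its last state: it reaches \<open>?B\<close> exactly
      if the past lies in \<open>?A\<close> and the new state is \<open>v\<close>.\<close>
    have step: "emeasure (IT.eP (Suc n) \<omega>) ?B = ennreal (pmf (K n u) v) * indicator ?A \<omega>"
      if \<omega>: "\<omega> \<in> space ?C" for \<omega>
    proof -
      have \<omega>': "\<omega> \<in> space (PiM {0..<Suc n} N)" using \<omega> C_space by simp
      then have ext: "\<omega> \<in> extensional {0..<Suc n}" and Sn: "\<omega> n \<in> S n"
        by (auto simp: space_PiM PiE_iff N_def)
      have up: "fun_upd \<omega> (Suc n) x \<in> space (PiM {0..<Suc (Suc n)} N)" if "x \<in> S (Suc n)" for x
        using \<omega>' that by (auto simp: space_PiM PiE_iff N_def extensional_def less_Suc_eq)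
      have re: "restrict (fun_upd \<omega> (Suc n) x) {0..<Suc n} = \<omega>" for x
        using ext by (auto simp: restrict_def fun_eq_iff extensional_def)
      have pre: "(\<lambda>x. fun_upd \<omega> (Suc n) x) -` ?B \<inter> space (N (Suc n)) =
          (if \<omega> \<in> ?A then {v} \<inter> S (Suc n) else {})"
        using up re \<omega>' by (auto simp: N_def)
      have "emeasure (IT.eP (Suc n) \<omega>) ?B = emeasure (P (Suc n) \<omega>) (if \<omega> \<in> ?A then {v} \<inter> S (Suc n) else {})"
        using IT.emeasure_eP[OF \<omega>' B'] pre by simp
      also have "\<dots> = ennreal (pmf (K n u) v) * indicator ?A \<omega>"
      proof (cases "\<omega> \<in> ?A")
        case True
        then have "emeasure (P (Suc n) \<omega>) ({v} \<inter> S (Suc n)) = emeasure (measure_pmf (K n u)) ({v} \<inter> S (Suc n))"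
          by (auto simp: P_def emeasure_restrict_space)
        also have "\<dots> = pmf (K n u) v"
        proof (cases "v \<in> S (Suc n)")
          case False
          then have "v \<notin> set_pmf (K n u)" using closed[OF Sn] True by auto
          then show ?thesis using False by (simp add: set_pmf_eq)
        qed (simp add: emeasure_pmf_single)
        finally show ?thesis using True by simp
      next
        case False
        then have "indicator ?A \<omega> = (0::ennreal)" by (rule indicator_simps)
        then show ?thesis by (simp only: False if_False emeasure_empty mult_zero_right)
      qed
      finally show ?thesis .
    qed
    have "emeasure ?L {\<omega>\<in>space ?L. restrict \<omega> {0..<Suc n} \<in> A \<and> \<omega> n = u \<and> \<omega> (Suc n) = v}
        = emeasure ?L {\<omega>\<in>space ?L. restrict \<omega> {0..<Suc (Suc n)} \<in> ?B}"
      by (rule arg_cong[where f="emeasure ?L"]) (use inL restr in auto)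
    also have "\<dots> = emeasure (?C \<bind> IT.eP (Suc n)) ?B"
      using cyl[OF B'] by simp
    also have "\<dots> = (\<integral>\<^sup>+\<omega>. emeasure (IT.eP (Suc n) \<omega>) ?B \<partial>?C)"
    proof (rule emeasure_bind)
      show "space ?C \<noteq> {}" using IT.prob_space_C[OF u0, of "Suc n"] prob_space.not_empty by auto
      show "IT.eP (Suc n) \<in> measurable ?C (subprob_algebra (PiM {0..<Suc (Suc n)} N))"
        using IT.measurable_eP[of "Suc n"] measurable_cong_sets[OF C_sets refl] by blast
    qed (rule B')
    also have "\<dots> = (\<integral>\<^sup>+\<omega>. ennreal (pmf (K n u) v) * indicator ?A \<omega> \<partial>?C)"
      by (intro nn_integral_cong) (simp only: step)
    also have "\<dots> = pmf (K n u) v * emeasure ?C ?A"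
      using A' by (intro nn_integral_cmult_indicator) (simp only: C_sets)
    also have "emeasure ?C ?A = emeasure ?L {\<omega>\<in>space ?L. restrict \<omega> {0..<Suc n} \<in> ?A}"
      using cyl[OF A'] by simp
    also have "{\<omega>\<in>space ?L. restrict \<omega> {0..<Suc n} \<in> ?A} = {\<omega>\<in>space ?L. restrict \<omega> {0..<Suc n} \<in> A \<and> \<omega> n = u}"
      using inL by auto
    finally show "\<P>(\<omega> in ?L. restrict \<omega> {0..<Suc n} \<in> A \<and> \<omega> n = u \<and> \<omega> (Suc n) = v) =
       \<P>(\<omega> in ?L. restrict \<omega> {0..<Suc n} \<in> A \<and> \<omega> n = u) * pmf (K n u) v"
      by (simp only: measure_def enn2real_mult enn2real_ennreal[OF pmf_nonneg] mult.commute)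
  qed
qed

lemma up_chain_exists:
  assumes U: "\<And>i u. i \<ge> 1 \<Longrightarrow> u \<in> partitions i \<Longrightarrow> set_pmf (U u) \<subseteq> partitions (Suc i)"
  obtains M :: "(nat \<Rightarrow> nat multiset) measure" and X where "up_chain U M X"
proof -
  let ?S = "\<lambda>n. partitions (Suc n)"
  let ?N = "\<lambda>n. count_space (?S n)"
  obtain M :: "(nat \<Rightarrow> nat multiset) measure" where
    "prob_space M" and sets_M: "sets M = sets (PiM UNIV ?N)" and
    step: "\<And>n A u v. A \<in> sets (PiM {0..<Suc n} ?N) \<Longrightarrow>
       \<P>(\<omega> in M. restrict \<omega> {0..<Suc n} \<in> A \<and> \<omega> n = u \<and> \<omega> (Suc n) = v) =
       \<P>(\<omega> in M. restrict \<omega> {0..<Suc n} \<in> A \<and> \<omega> n = u) * pmf (U u) v"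
  proof (rule inhomogeneous_Markov_measure[of "{#1#}" ?S "\<lambda>_. U"])
    show "{#1#} \<in> ?S 0" using partitions_1 by simp
    show "set_pmf (U u) \<subseteq> ?S (Suc n)" if "u \<in> ?S n" for n u using U that by simp
  qed blast
  interpret prob_space M by fact
  have space_M: "space M = space (PiM UNIV ?N)" by (rule sets_eq_imp_space_eq[OF sets_M])
  have inS: "\<omega> j \<in> ?S j" if "\<omega> \<in> space M" for \<omega> j
    using that by (auto simp: space_M space_PiM PiE_iff)
  \<comment> \<open>Paths are indexed from 0, chains of partitions from 1.\<close>
  define X where "X i \<omega> = \<omega> (i - 1)" for i and \<omega> :: "nat \<Rightarrow> nat multiset"
  have meas: "X (Suc n) \<in> measurable M (?N n)" for n
  proof -
    have "X (Suc n) = (\<lambda>\<omega>. \<omega> n)" by (simp add: X_def fun_eq_iff)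
    then show ?thesis
      by (simp only: measurable_cong_sets[OF sets_M refl])
        (rule measurable_component_singleton[OF UNIV_I, of n ?N])
  qed
  have event: "{\<omega>\<in>space M. X (Suc n) \<omega> = u} \<in> events" for n u
  proof -
    have "{\<omega>\<in>space M. X (Suc n) \<omega> = u} = X (Suc n) -` ({u} \<inter> ?S n) \<inter> space M"
      using inS by (auto simp: X_def)
    then show ?thesis using measurable_sets[OF meas, of "{u} \<inter> ?S n" n] by simp
  qed
  have one: "\<P>(\<omega> in M. X (Suc n) \<omega> = u \<and> X (Suc n + 1) \<omega> = v) =
      \<P>(\<omega> in M. X (Suc n) \<omega> = u) * pmf (U u) v" for n u v
  proof -
    have "restrict \<omega> {0..<Suc n} \<in> space (PiM {0..<Suc n} ?N)" if "\<omega> \<in> space M" for \<omega>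
      using inS[OF that] by (auto simp: space_PiM)
    then show ?thesis using step[OF sets.top, of n u v] by (simp add: X_def cong: conj_cong)
  qed
  \<comment> \<open>A prescribed history up to time \<open>Suc n\<close> is a measurable box, which fixes the last state, so
    that conditioning on it or on the last state alone gives the same transition probability.\<close>
  have hist: "\<P>(\<omega> in M. X (Suc n + 1) \<omega> = v \<and> (\<forall>j\<in>{1..Suc n}. X j \<omega> = x j)) =
      \<P>(\<omega> in M. \<forall>j\<in>{1..Suc n}. X j \<omega> = x j) * pmf (U (x (Suc n))) v" for n x v
  proof -
    let ?A = "PiE {0..<Suc n} (\<lambda>j. {x (Suc j)} \<inter> ?S j)"
    have A: "?A \<in> sets (PiM {0..<Suc n} ?N)" by (rule sets_PiM_I_finite) auto
    have iff: "(\<forall>j\<in>{1..Suc n}. X j \<omega> = x j) \<longleftrightarrow> restrict \<omega> {0..<Suc n} \<in> ?A" if "\<omega> \<in> space M" for \<omega>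
    proof -
      have "(\<forall>j\<in>{1..Suc n}. X j \<omega> = x j) \<longleftrightarrow> (\<forall>j\<in>{..<Suc n}. \<omega> j = x (Suc j))"
      proof (intro iffI ballI)
        fix j assume *: "\<forall>j\<in>{1..Suc n}. X j \<omega> = x j" and "j \<in> {..<Suc n}"
        then show "\<omega> j = x (Suc j)" using bspec[OF *, of "Suc j"] by (simp add: X_def)
      next
        fix j assume *: "\<forall>j\<in>{..<Suc n}. \<omega> j = x (Suc j)" and "j \<in> {1..Suc n}"
        then show "X j \<omega> = x j" by (cases j) (auto simp: X_def)
      qed
      then show ?thesis using inS[OF that] by (auto simp: X_def PiE_iff)
    qed
    have last: "\<omega> n = x (Suc n)" if "restrict \<omega> {0..<Suc n} \<in> ?A" for \<omega>
      using that by (auto simp: PiE_iff dest: bspec[of _ _ n])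
    have e1: "{\<omega>\<in>space M. X (Suc n + 1) \<omega> = v \<and> (\<forall>j\<in>{1..Suc n}. X j \<omega> = x j)} =
      {\<omega>\<in>space M. restrict \<omega> {0..<Suc n} \<in> ?A \<and> \<omega> n = x (Suc n) \<and> \<omega> (Suc n) = v}"
      using iff last by (auto simp: X_def simp del: restrict_PiE_iff)
    have e2: "{\<omega>\<in>space M. \<forall>j\<in>{1..Suc n}. X j \<omega> = x j} =
      {\<omega>\<in>space M. restrict \<omega> {0..<Suc n} \<in> ?A \<and> \<omega> n = x (Suc n)}"
      using iff last by (auto simp del: restrict_PiE_iff)
    show ?thesis unfolding e1 e2 by (rule step[OF A])
  qed
  have "up_chain U M X"
    unfolding up_chain_def markov_chain_def
  proof (intro conjI allI impI)
    show "prob_space M" by fact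
  next
    fix i :: nat assume "i \<ge> 1"
    then obtain n where i: "i = Suc n" by (cases i) auto
    show "X i \<in> measurable M (count_space (partitions i))" using meas by (simp add: i)
    show "\<P>(\<omega> in M. X i \<omega> = u \<and> X (i + 1) \<omega> = v) = \<P>(\<omega> in M. X i \<omega> = u) * pmf (U u) v" for u v
      using one by (simp add: i)
    fix x :: "nat \<Rightarrow> nat multiset"
    assume pos: "\<P>(\<omega> in M. \<forall>j\<in>{1..i}. X j \<omega> = x j) > 0"
    have "\<P>(\<omega> in M. \<forall>j\<in>{1..i}. X j \<omega> = x j) \<le> \<P>(\<omega> in M. X i \<omega> = x i)"
      by (rule finite_measure_mono) (use \<open>i \<ge> 1\<close> event i in auto)
    with pos have pos': "\<P>(\<omega> in M. X i \<omega> = x i) > 0" by simp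
    have "\<P>(\<omega> in M. X (i + 1) \<omega> = x (i + 1) \<bar> \<forall>j\<in>{1..i}. X j \<omega> = x j) = pmf (U (x i)) (x (i + 1))"
      using hist[of n "x (i + 1)" x] pos by (simp add: cond_prob_def i)
    also have "\<dots> = \<P>(\<omega> in M. X (i + 1) \<omega> = x (i + 1) \<bar> X i \<omega> = x i)"
      using one[of n "x i" "x (i + 1)"] pos' by (simp add: cond_prob_def i conj_commute)
    finally show "\<P>(\<omega> in M. X (i + 1) \<omega> = x (i + 1) \<bar> \<forall>j\<in>{1..i}. X j \<omega> = x j) =
        \<P>(\<omega> in M. X (i + 1) \<omega> = x (i + 1) \<bar> X i \<omega> = x i)" .
  qed
  then show thesis by (rule that)
qed

section \<open>The law of the row chain and its reversal\<close>

lemma markov_chain_prob_outside: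
  assumes "markov_chain M X" "i \<ge> 1" "u \<notin> partitions i"
  shows "\<P>(\<omega> in M. X i \<omega> = u \<and> Q \<omega>) = 0"
proof -
  have "{\<omega>\<in>space M. X i \<omega> = u \<and> Q \<omega>} = {}"
    using assms measurable_space[of "X i" M "count_space (partitions i)"]
    by (auto simp: markov_chain_def)
  then show ?thesis by (simp only: measure_empty)
qed

lemma markov_chain_event:
  assumes "markov_chain M X" "i \<ge> 1"
  shows "{\<omega>\<in>space M. X i \<omega> = u} \<in> sets M"
proof -
  have m: "X i \<in> measurable M (count_space (partitions i))" using assms by (simp add: markov_chain_def)
  have "{\<omega>\<in>space M. X i \<omega> = u} = X i -` ({u} \<inter> partitions i) \<inter> space M"
    using measurable_space[OF m] by auto
  then show ?thesis using measurable_sets[OF m, of "{u} \<inter> partitions i"] by simp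
qed

text \<open>Summing detailed balance over the predecessors \<open>u\<close> of \<open>\<nu>\<close> turns the law at time \<open>i\<close>, pushed up, into
  \<open>row_law \<mu> \<nu>\<close> times the total mass of \<open>derow_rule \<nu>\<close>, which is 1.\<close>

lemma row_chain_law:
  assumes \<mu>: "0 < \<mu>" "\<mu> < 1" and chain: "up_chain (row_rule \<mu>) M X"
  shows "i \<ge> 1 \<Longrightarrow> \<nu> \<in> partitions i \<Longrightarrow> \<P>(\<omega> in M. X i \<omega> = \<nu>) = row_law \<mu> \<nu>"
proof (induction i arbitrary: \<nu> rule: nat_induct_at_least)
  have mc: "markov_chain M X" using chain by (simp add: up_chain_def)
  interpret prob_space M using mc by (simp add: markov_chain_def)
  have inP: "X i \<omega> \<in> partitions i" if "i \<ge> 1" "\<omega> \<in> space M" for i \<omega>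
    using mc that measurable_space[of "X i" M "count_space (partitions i)"] by (auto simp: markov_chain_def)
  {
    case base
    then have \<nu>: "\<nu> = {#1#}" using partitions_1 by simp
    have "{\<omega>\<in>space M. X 1 \<omega> = \<nu>} = space M" using inP[of 1] partitions_1 \<nu> by auto
    then show ?case using \<nu> prob_space by (simp add: row_law_def arrangements_def)
  next
    case (Suc i)
    have "{\<omega>\<in>space M. X (Suc i) \<omega> = \<nu>} = (\<Union>u\<in>partitions i. {\<omega>\<in>space M. X i \<omega> = u \<and> X (i + 1) \<omega> = \<nu>})"
      using inP Suc by auto
    then have "\<P>(\<omega> in M. X (Suc i) \<omega> = \<nu>) = prob (\<Union>u\<in>partitions i. {\<omega>\<in>space M. X i \<omega> = u \<and> X (i + 1) \<omega> = \<nu>})"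
      by simp
    also have "\<dots> = (\<Sum>u\<in>partitions i. \<P>(\<omega> in M. X i \<omega> = u \<and> X (i + 1) \<omega> = \<nu>))"
    proof (rule finite_measure_finite_Union[OF finite_partitions])
      have "{\<omega>\<in>space M. X i \<omega> = u \<and> X (i + 1) \<omega> = \<nu>} \<in> events" for u
        using sets.Int[OF markov_chain_event[OF mc, of i u] markov_chain_event[OF mc, of "i + 1" \<nu>]] Suc
        by (auto simp: Int_def conj_ac elim!: back_subst[of "\<lambda>A. A \<in> events"])
      then show "(\<lambda>u. {\<omega>\<in>space M. X i \<omega> = u \<and> X (i + 1) \<omega> = \<nu>}) ` partitions i \<subseteq> events" by blast
    qed (auto simp: disjoint_family_on_def)
    also have "\<dots> = (\<Sum>u\<in>partitions i. row_law \<mu> u * pmf (row_rule \<mu> u) \<nu>)"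
      using chain Suc by (intro sum.cong) (auto simp: up_chain_def)
    also have "\<dots> = (\<Sum>u\<in>partitions i. row_law \<mu> \<nu> * pmf (derow_rule \<nu>) u)"
      using Suc by (intro sum.cong detailed_balance[OF \<mu>, where i=i]) auto
    also have "\<dots> = row_law \<mu> \<nu> * measure (derow_rule \<nu>) (partitions i)"
      by (simp add: measure_measure_pmf_finite[OF finite_partitions] sum_distrib_left)
    also have "measure (derow_rule \<nu>) (partitions i) = 1"
      using set_pmf_derow_rule[of \<nu> i] Suc by (intro measure_pmf.prob_eq_1[THEN iffD2]) (auto simp: AE_measure_pmf_iff)
    finally show ?case by simp
  }
qed

text \<open>With the law known, detailed balance says that the joint distribution of two consecutive states
  is that of a step of the down rule. The very same chain thus witnesses both halves of
  compatibility.\<close>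

lemma row_chain_reverse:
  assumes \<mu>: "0 < \<mu>" "\<mu> < 1" and chain: "up_chain (row_rule \<mu>) M X"
  shows "down_chain derow_rule M X"
  unfolding down_chain_def
proof (intro conjI allI impI)
  show mc: "markov_chain M X" using chain by (simp add: up_chain_def)
  fix i :: nat and u v assume "i \<ge> 2"
  then obtain j where j: "i = Suc j" "j \<ge> 1" by (cases i) auto
  have swap: "\<P>(\<omega> in M. X i \<omega> = u \<and> X (i - 1) \<omega> = v) = \<P>(\<omega> in M. X j \<omega> = v \<and> X i \<omega> = u)"
    using j by (simp add: conj_commute)
  show "\<P>(\<omega> in M. X i \<omega> = u \<and> X (i - 1) \<omega> = v) = \<P>(\<omega> in M. X i \<omega> = u) * pmf (derow_rule u) v"
  proof (cases "u \<in> partitions i")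
    case False
    then show ?thesis using markov_chain_prob_outside[OF mc _ False] markov_chain_prob_outside[OF mc _ False, of "\<lambda>_. True"] j
      by simp
  next
    case u: True
    show ?thesis
    proof (cases "v \<in> partitions j")
      case False
      then have "pmf (derow_rule u) v = 0"
        using set_pmf_derow_rule[of u j] u j by (auto simp: set_pmf_eq)
      then show ?thesis unfolding swap using markov_chain_prob_outside[OF mc j(2) False] by simp
    next
      case True
      have "\<P>(\<omega> in M. X j \<omega> = v \<and> X i \<omega> = u) = row_law \<mu> v * pmf (row_rule \<mu> v) u"
        using chain j row_chain_law[OF \<mu> chain j(2) True] by (auto simp: up_chain_def)
      also have "\<dots> = row_law \<mu> u * pmf (derow_rule u) v"
        using detailed_balance[OF \<mu> True j(2)] u j by simp
      also have "row_law \<mu> u = \<P>(\<omega> in M. X i \<omega> = u)"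
        using row_chain_law[OF \<mu> chain _ u] j by simp
      finally show ?thesis unfolding swap .
    qed
  qed
qed

theorem corollary1:
  fixes \<mu> :: real
  assumes "0 < \<mu>" and "\<mu> < 1"
  shows "compatible (row_rule \<mu>) derow_rule \<and>
    (\<forall>(M :: 'w measure) X. up_chain (row_rule \<mu>) M X \<longrightarrow>
      (\<forall>i\<ge>1. \<forall>\<nu>\<in>partitions i.
        \<P>(\<omega> in M. X i \<omega> = \<nu>) =
          (1 - \<mu>) ^ (i - size \<nu>) * \<mu> ^ (size \<nu> - 1) *
          (fact (size \<nu>) / (\<Prod>k\<in>set_mset \<nu>. fact (count \<nu> k)))))"
proof (intro conjI allI impI ballI)
  obtain M :: "(nat \<Rightarrow> nat multiset) measure" and X where "up_chain (row_rule \<mu>) M X"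
    by (rule up_chain_exists[of "row_rule \<mu>"]) (use set_pmf_row_rule in auto)
  then show "compatible (row_rule \<mu>) derow_rule"
    using row_chain_reverse[OF assms] unfolding compatible_def by blast
next
  fix M :: "'w measure" and X i \<nu>
  assume "up_chain (row_rule \<mu>) M X" "i \<ge> 1" and \<nu>: "\<nu> \<in> partitions i"
  from row_chain_law[OF assms this] \<nu>
  show "\<P>(\<omega> in M. X i \<omega> = \<nu>) =
      (1 - \<mu>) ^ (i - size \<nu>) * \<mu> ^ (size \<nu> - 1) *
      (fact (size \<nu>) / (\<Prod>k\<in>set_mset \<nu>. fact (count \<nu> k)))"
    by (simp add: row_law_def arrangements_def partitions_def)
qed

end
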